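(* Let $p:Y\to X$ be a Galois cover of finite graphs with Galois group $\mathrm{Gal}(Y/X)\cong\mathfrak S_3$. Let $Q=Y/\langle(1,2,3)\rangle$ and $T=Y/\langle(1,2)\rangle$ be the intermediate covers corresponding to the cyclic subgroups $\langle(1,2,3)\rangle$ and $\langle(1,2)\rangle$ of $\mathfrak S_3$, respectively. Then, as multisets, \[ \mathrm{Spec}(Y)\cup\mathrm{Spec}(X)\cup\mathrm{Spec}(X)=\mathrm{Spec}(Q)\cup\mathrm{Spec}(T)\cup\mathrm{Spec}(T). \]
   Context: $\mathrm{Spec}(\Gamma)$ is the multiset of eigenvalues (with multiplicity) of the adjacency matrix of a finite graph $\Gamma$, and $\cup$ is the union of multisets in which multiplicities add. Graphs are finite simple graphs. A covering map $p:\tilde X\to X$ is a surjective graph morphism such that for every vertex $\tilde v$ of $\tilde X$, $p$ induces a bijection from the set of edges incident to $\tilde v$ to the set of edges incident to $p(\tilde v)$. A cover $p:\tilde X\to X$ is Galois with Galois group $G=\mathrm{Gal}(\tilde X/X)$ if $G$ acts on $\tilde X$ (by graph automorphisms), acts freely and transitively on each fiber $p^{-1}(w)$, $w\in V(X)$, and $\tilde X/G$ is isomorphic to $X$. For a subgroup $H\le G$, the quotient graph $\tilde X/H$ has the $H$-orbits of vertices as vertices, two orbits being adjacent iff some representatives are adjacent; it is an intermediate cover $\tilde X\to\tilde X/H\to X$. *)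

theory Defs
  imports
    "Graph_Theory.Pair_Digraph"
    "Graph_Theory.Digraph_Isomorphism"
    "Jordan_Normal_Form.Char_Poly"
    "HOL-Algebra.Group_Action"
    "HOL-Algebra.Sym_Groups"
begin

text \<open>
  A finite simple graph is a \<^locale>\<open>pair_graph\<close>: a finite vertex set with a symmetric, irreflexive
  set of arcs, each undirected edge being represented by its two opposite arcs. The edges incident
  to a vertex \<open>v\<close> thus correspond one-to-one to the arcs with tail \<open>v\<close>.
\<close>

definition vertex_list :: "'a pair_pre_digraph \<Rightarrow> 'a list" where
  "vertex_list \<Gamma> = (SOME vs. distinct vs \<and> set vs = pverts \<Gamma>)"

definition adjacency_matrix :: "'a pair_pre_digraph \<Rightarrow> complex mat" where
  "adjacency_matrix \<Gamma> =
     (let vs = vertex_list \<Gamma>; n = length vs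
      in mat n n (\<lambda>(i, j). if (vs ! i, vs ! j) \<in> parcs \<Gamma> then 1 else 0))"

text \<open>
  The multiset of complex roots of the characteristic polynomial. It does not depend on the chosen
  enumeration of the vertices; since the adjacency matrix is real symmetric, all its elements are
  real and algebraic and geometric multiplicities agree.
\<close>

definition Spec :: "'a pair_pre_digraph \<Rightarrow> complex multiset" where
  "Spec \<Gamma> = proots (char_poly (adjacency_matrix \<Gamma>))"

text \<open>
  A graph morphism \<open>p\<close> maps an edge \<open>{u, v}\<close> to \<open>{p u, p v}\<close>, that is, arcs by \<open>map_prod p p\<close>.
\<close>

definition covering_map ::
  "'a pair_pre_digraph \<Rightarrow> 'b pair_pre_digraph \<Rightarrow> ('a \<Rightarrow> 'b) \<Rightarrow> bool" where
  "covering_map Y X p \<longleftrightarrow>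
     p ` pverts Y = pverts X \<and>
     (\<forall>(u, v) \<in> parcs Y. (p u, p v) \<in> parcs X) \<and>
     (\<forall>v \<in> pverts Y.
        bij_betw (map_prod p p) (out_arcs (with_proj Y) v) (out_arcs (with_proj X) (p v)))"

definition fibre :: "'a pair_pre_digraph \<Rightarrow> ('a \<Rightarrow> 'b) \<Rightarrow> 'b \<Rightarrow> 'a set" where
  "fibre Y p w = {v \<in> pverts Y. p v = w}"

text \<open>
  The quotient of \<open>Y\<close> by the restriction to \<open>H\<close> of the action \<open>act\<close> of \<open>G\<close> on the vertices.
\<close>

definition quotient_graph ::
  "'a pair_pre_digraph \<Rightarrow> ('g, 'm) monoid_scheme \<Rightarrow> ('g \<Rightarrow> 'a \<Rightarrow> 'a) \<Rightarrow> 'g set \<Rightarrow>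
     'a set pair_pre_digraph" where
  "quotient_graph Y G act H =
     (let \<O> = orbits (G\<lparr>carrier := H\<rparr>) (pverts Y) act
      in \<lparr>pverts = \<O>,
          parcs = {(A, B). A \<in> \<O> \<and> B \<in> \<O> \<and> (\<exists>a \<in> A. \<exists>b \<in> B. (a, b) \<in> parcs Y)}\<rparr>)"

definition galois_cover ::
  "'a pair_pre_digraph \<Rightarrow> 'b pair_pre_digraph \<Rightarrow> ('a \<Rightarrow> 'b) \<Rightarrow> ('g, 'm) monoid_scheme \<Rightarrow>
     ('g \<Rightarrow> 'a \<Rightarrow> 'a) \<Rightarrow> bool" where
  "galois_cover Y X p G act \<longleftrightarrow>
     covering_map Y X p \<and>
     group_action G (pverts Y) act \<and>
     (\<forall>g \<in> carrier G. \<forall>u \<in> pverts Y. \<forall>v \<in> pverts Y.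
        (act g u, act g v) \<in> parcs Y \<longleftrightarrow> (u, v) \<in> parcs Y) \<and>
     (\<forall>w \<in> pverts X.
        (\<forall>g \<in> carrier G. \<forall>v \<in> fibre Y p w. act g v \<in> fibre Y p w) \<and>
        (\<forall>v \<in> fibre Y p w. stabilizer G act v = {\<one>\<^bsub>G\<^esub>}) \<and>
        (\<forall>u \<in> fibre Y p w. \<forall>v \<in> fibre Y p w. \<exists>g \<in> carrier G. act g u = v)) \<and>
     digraph_iso (with_proj (quotient_graph Y G act (carrier G))) (with_proj X)"

end

theory Submission
  imports Defs "Jordan_Normal_Form.Schur_Decomposition"
begin

text \<open>
  A multiset of complex numbers is determined by its power sums, and the \<open>k\<close>-th power sum of
  \<open>Spec \<Gamma>\<close> is the number of closed walks of length \<open>k\<close> in \<open>\<Gamma>\<close>. Lifting walks along \<open>Y \<rightarrow> Y/H\<close>,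
  the closed walks of \<open>Y/H\<close> number \<open>1/|H|\<close> times the sum over \<open>h \<in> H\<close> of \<open>F h\<close>, where \<open>F h\<close>
  counts the walks in \<open>Y\<close> from some \<open>u\<close> to \<open>h u\<close>. As \<open>F\<close> is a class function, in terms of its
  values at \<open>1\<close>, a transposition \<open>s\<close> and a 3-cycle \<open>c\<close> both sides of the claim amount to
  \<open>4/3 F 1 + F s + 2/3 F c\<close>.
\<close>

section \<open>Multisets determined by their power sums\<close>

lemma sum_mset_poly_eq_if_power_sums_eq:
  fixes M N :: "'a::comm_ring_1 multiset"
  assumes "\<And>k. (\<Sum>x\<in>#M. x ^ k) = (\<Sum>x\<in>#N. x ^ k)"
  shows "(\<Sum>x\<in>#M. poly p x) = (\<Sum>x\<in>#N. poly p x)"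
proof -
  \<comment> \<open>The factor \<open>x ^ k\<close> with arbitrary \<open>k\<close> carries the
    induction: peeling off a coefficient multiplies the remaining polynomial by \<open>x\<close>,
    which is absorbed by passing to \<open>Suc k\<close>.\<close>
  have "(\<Sum>x\<in>#M. x ^ k * poly p x) = (\<Sum>x\<in>#N. x ^ k * poly p x)" for k
  proof (induction p arbitrary: k)
    case (pCons a p)
    have "(\<Sum>x\<in>#A. x ^ k * poly (pCons a p) x)
        = a * (\<Sum>x\<in>#A. x ^ k) + (\<Sum>x\<in>#A. x ^ Suc k * poly p x)" for A
      by (simp add: algebra_simps sum_mset.distrib sum_mset_distrib_left image_mset.compositionality comp_def)
    then show ?case using assms pCons.IH[of "Suc k"] by presburger
  qed simp
  from this[of 0] show ?thesis by simp
qed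

lemma sum_mset_eq_single:
  fixes g :: "'a \<Rightarrow> 'b::comm_semiring_1"
  assumes "\<And>y. y \<in># M \<Longrightarrow> y \<noteq> x \<Longrightarrow> g y = 0"
  shows "(\<Sum>y\<in>#M. g y) = of_nat (count M x) * g x"
  using assms by (induction M) (auto simp: algebra_simps)

text \<open>Summing a polynomial that vanishes at every element other than \<open>x\<close>, but not
  at \<open>x\<close>, isolates the multiplicity of \<open>x\<close>. Characteristic 0 then recovers
  the count from its image under \<open>of_nat\<close>.\<close>

lemma multiset_eq_if_power_sums_eq:
  fixes M N :: "'a::{idom, ring_char_0} multiset"
  assumes "\<And>k. (\<Sum>x\<in>#M. x ^ k) = (\<Sum>x\<in>#N. x ^ k)"
  shows "M = N"
proof (rule multiset_eqI)
  fix x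
  define S where "S = (set_mset M \<union> set_mset N) - {x}"
  define p where "p = (\<Prod>y\<in>S. [:- y, 1:])"
  have fin: "finite S" by (simp add: S_def)
  have px: "poly p x \<noteq> 0" using fin by (auto simp: p_def poly_prod S_def)
  have p0: "poly p y = 0" if "y \<in> S" for y
    using fin that by (auto simp: p_def poly_prod)
  have "of_nat (count M x) * poly p x = (\<Sum>y\<in>#M. poly p y)"
    by (rule sum_mset_eq_single[symmetric]) (auto intro!: p0 simp: S_def)
  also have "\<dots> = (\<Sum>y\<in>#N. poly p y)"
    by (rule sum_mset_poly_eq_if_power_sums_eq[OF assms])
  also have "\<dots> = of_nat (count N x) * poly p x"
    by (rule sum_mset_eq_single) (auto intro!: p0 simp: S_def)
  finally show "count M x = count N x" using px by simp
qed

section \<open>Power sums of eigenvalues as traces of matrix powers\<close>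

text \<open>The diagonal sum is the trace. Since tr(CD) = tr(DC), the trace of
  \<open>P * B * Q\<close> is that of \<open>Q * P * B\<close>, and \<open>Q * P\<close> is the
  identity.\<close>

lemma sum_diag_similar:
  fixes A B :: "'a::comm_ring_1 mat"
  assumes "similar_mat_wit A B P Q" and n: "n = dim_row A"
  shows "(\<Sum>i<n. A $$ (i, i)) = (\<Sum>i<n. B $$ (i, i))"
proof -
  from similar_mat_witD[OF n assms(1)]
  have carr: "A \<in> carrier_mat n n" "B \<in> carrier_mat n n" "P \<in> carrier_mat n n" "Q \<in> carrier_mat n n"
    and QP: "Q * P = 1\<^sub>m n" and A: "A = P * B * Q" by auto
  have commute: "(\<Sum>i<n. (C * D) $$ (i, i)) = (\<Sum>i<n. (D * C) $$ (i, i))"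
    if "C \<in> carrier_mat n n" "D \<in> carrier_mat n n" for C D :: "'a mat"
    using that by (simp add: scalar_prod_def lessThan_atLeast0, subst sum.swap, simp add: mult.commute)
  have "(\<Sum>i<n. A $$ (i, i)) = (\<Sum>i<n. (Q * (P * B)) $$ (i, i))"
    unfolding A using carr by (intro commute) auto
  also have "Q * (P * B) = B"
    using carr QP assoc_mult_mat[of Q n n P n B n] by simp
  finally show ?thesis .
qed

text \<open>On and below the diagonal the induction closes by itself: in the sum for entry
  \<open>(i, j)\<close> the left factor vanishes for \<open>l < i\<close> by induction, and the
  right one for \<open>l > i \<ge> j\<close> by triangularity, which leaves only
  \<open>l = i\<close>.\<close>

lemma upper_triangular_pow:
  fixes B :: "'a::comm_ring_1 mat"
  assumes B: "B \<in> carrier_mat n n" and ut: "upper_triangular B" and "i < n" and "j \<le> i"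
  shows "(B ^\<^sub>m k) $$ (i, j) = (if i = j then (B $$ (i, i)) ^ k else 0)"
  using \<open>i < n\<close> \<open>j \<le> i\<close>
proof (induction k arbitrary: i j)
  case 0
  then show ?case using B by simp
next
  case (Suc k)
  have entry: "(B ^\<^sub>m k) $$ (i, l) * B $$ (l, j) = (if l = i \<and> i = j then (B $$ (i, i)) ^ Suc k else 0)"
    if "l < n" for l
  proof (cases "l \<le> i")
    case True
    then show ?thesis using Suc.IH[of i l] Suc.prems ut B by (auto simp: upper_triangular_def)
  next
    case False
    then show ?thesis using ut B Suc.prems that by (auto simp: upper_triangular_def)
  qed
  have "(B ^\<^sub>m Suc k) $$ (i, j) = (\<Sum>l<n. (B ^\<^sub>m k) $$ (i, l) * B $$ (l, j))"
    using B Suc.prems by (simp add: scalar_prod_def lessThan_atLeast0)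
  also have "\<dots> = (\<Sum>l<n. if l = i then (if i = j then (B $$ (i, i)) ^ Suc k else 0) else 0)"
    by (rule sum.cong) (auto simp: entry)
  finally show ?case using Suc.prems by simp
qed

text \<open>The characteristic polynomial splits over the complex numbers, so Schur decomposition
  gives a similar triangular \<open>B\<close> whose diagonal lists the eigenvalues with
  multiplicity. The diagonal of its \<open>k\<close>-th power lists their \<open>k\<close>-th
  powers, and the \<open>k\<close>-th powers of \<open>A\<close> and \<open>B\<close> are again
  similar, hence have equal trace.\<close>

lemma power_sum_proots_char_poly:
  fixes A :: "complex mat"
  assumes A: "A \<in> carrier_mat n n"
  shows "(\<Sum>x\<in>#proots (char_poly A). x ^ k) = (\<Sum>i<n. (A ^\<^sub>m k) $$ (i, i))"
proof -
  obtain es where es: "char_poly A = (\<Prod>a\<leftarrow>es. [:- a, 1:])"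
    using char_poly_factorized[OF A] by auto
  obtain B P Q where "schur_decomposition A es = (B, P, Q)" by (metis prod_cases3)
  from schur_decomposition[OF A es this]
  have sim: "similar_mat_wit A B P Q" and ut: "upper_triangular B" and diag: "diag_mat B = es"
    by auto
  from similar_mat_witD2[OF A sim] have B: "B \<in> carrier_mat n n" by simp
  have "proots (char_poly A) = mset es"
    unfolding es
  proof (induction es)
    case (Cons a es)
    have "(\<Prod>a\<leftarrow>es. [:- a, 1:]) \<noteq> 0" by (auto simp: prod_list_zero_iff)
    then have "proots ([:- a, 1:] * (\<Prod>a\<leftarrow>es. [:- a, 1:])) = add_mset a (mset es)"
      using Cons by (subst proots_mult) auto
    then show ?case by (simp only: list.map prod_list.Cons mset.simps)
  qed simp
  then have "(\<Sum>x\<in>#proots (char_poly A). x ^ k) = (\<Sum>x\<leftarrow>diag_mat B. x ^ k)"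
    by (simp add: diag flip: sum_mset_sum_list)
  also have "\<dots> = (\<Sum>i<n. (B $$ (i, i)) ^ k)"
    using B by (simp add: diag_mat_def comp_def interv_sum_list_conv_sum_set_nat lessThan_atLeast0)
  also have "\<dots> = (\<Sum>i<n. (B ^\<^sub>m k) $$ (i, i))"
    using upper_triangular_pow[OF B ut] by simp
  also have "\<dots> = (\<Sum>i<n. (A ^\<^sub>m k) $$ (i, i))"
    using sum_diag_similar[OF similar_mat_wit_pow[OF sim], of n k] A by simp
  finally show ?thesis .
qed

section \<open>Walk counts as entries of powers of the adjacency matrix\<close>

text \<open>The recursion appends the last arc, in step with
  \<open>A ^\<^sub>m Suc k = A ^\<^sub>m k * A\<close>, and leaves the starting vertex fixed, as the
  lifting argument requires.\<close>

primrec num_walks :: "'a pair_pre_digraph \<Rightarrow> nat \<Rightarrow> 'a \<Rightarrow> 'a \<Rightarrow> nat" where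
  "num_walks \<Gamma> 0 u v = of_bool (u = v)"
| "num_walks \<Gamma> (Suc k) u v =
     (\<Sum>w\<in>pverts \<Gamma>. num_walks \<Gamma> k u w * of_bool ((w, v) \<in> parcs \<Gamma>))"

definition num_closed_walks :: "'a pair_pre_digraph \<Rightarrow> nat \<Rightarrow> nat" where
  "num_closed_walks \<Gamma> k = (\<Sum>v\<in>pverts \<Gamma>. num_walks \<Gamma> k v v)"

lemma power_sum_Spec:
  assumes "finite (pverts \<Gamma>)"
  shows "(\<Sum>x\<in>#Spec \<Gamma>. x ^ k) = of_nat (num_closed_walks \<Gamma> k)"
proof -
  define vs where "vs = vertex_list \<Gamma>"
  define n where "n = length vs"
  define A where "A = adjacency_matrix \<Gamma>"
  \<comment> \<open>The choice behind \<open>vertex_list\<close> yields a genuine enumeration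
    because the vertex set is finite.\<close>
  have "distinct vs \<and> set vs = pverts \<Gamma>"
    unfolding vs_def vertex_list_def
    by (rule someI_ex) (use finite_distinct_list[OF assms] in blast)
  then have bij: "bij_betw ((!) vs) {..<n} (pverts \<Gamma>)"
    using bij_betw_nth[of vs] by (simp add: n_def)
  have A: "A \<in> carrier_mat n n"
    by (simp add: A_def adjacency_matrix_def Let_def n_def vs_def)
  have entry: "A $$ (i, j) = of_bool ((vs ! i, vs ! j) \<in> parcs \<Gamma>)" if "i < n" "j < n" for i j
    using that by (simp add: A_def adjacency_matrix_def Let_def n_def vs_def)
  have pow: "(A ^\<^sub>m k) $$ (i, j) = of_nat (num_walks \<Gamma> k (vs ! i) (vs ! j))"
    if "i < n" "j < n" for i j
    using that
  proof (induction k arbitrary: j)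
    case 0
    then show ?case using A bij by (auto simp: bij_betw_def inj_on_def)
  next
    case (Suc k)
    have "(A ^\<^sub>m Suc k) $$ (i, j) = (\<Sum>l<n. (A ^\<^sub>m k) $$ (i, l) * A $$ (l, j))"
      using A Suc.prems by (simp add: scalar_prod_def lessThan_atLeast0)
    also have "\<dots> = (\<Sum>l<n. of_nat (num_walks \<Gamma> k (vs ! i) (vs ! l)
                       * of_bool ((vs ! l, vs ! j) \<in> parcs \<Gamma>)))"
      using Suc by (intro sum.cong) (auto simp: entry)
    also have "\<dots> = of_nat (num_walks \<Gamma> (Suc k) (vs ! i) (vs ! j))"
      using sum.reindex_bij_betw[OF bij, of "\<lambda>w. num_walks \<Gamma> k (vs ! i) w
                       * of_bool ((w, vs ! j) \<in> parcs \<Gamma>)"]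
      by (simp flip: of_nat_sum)
    finally show ?case .
  qed
  have "(\<Sum>x\<in>#Spec \<Gamma>. x ^ k) = (\<Sum>i<n. of_nat (num_walks \<Gamma> k (vs ! i) (vs ! i)))"
    using power_sum_proots_char_poly[OF A, of k] pow by (simp add: Spec_def flip: A_def)
  also have "\<dots> = of_nat (num_closed_walks \<Gamma> k)"
    using sum.reindex_bij_betw[OF bij, of "\<lambda>v. num_walks \<Gamma> k v v"]
    by (simp add: num_closed_walks_def flip: of_nat_sum)
  finally show ?thesis .
qed

section \<open>Lifting walks along covering maps\<close>

text \<open>Unique lifting of a single arc: the local bijection at \<open>b\<close> provides exactly
  one lift of an arc \<open>(q b, z)\<close>, and a non-arc has no lift because \<open>q\<close>
  preserves arcs.\<close>

lemma num_lifts_covering_map: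
  assumes cov: "covering_map Y Z q" and b: "b \<in> pverts Y"
    and fin: "finite (pverts Y)" and wf: "parcs Y \<subseteq> pverts Y \<times> pverts Y"
  shows "(\<Sum>c\<in>fibre Y q z. of_bool ((b, c) \<in> parcs Y)) = (of_bool ((q b, z) \<in> parcs Z) :: nat)"
proof -
  have bij: "bij_betw (map_prod q q) (out_arcs (with_proj Y) b) (out_arcs (with_proj Z) (q b))"
    using cov b by (auto simp: covering_map_def)
  have "card (fibre Y q z \<inter> {c. (b, c) \<in> parcs Y}) = of_bool ((q b, z) \<in> parcs Z)"
  proof (cases "(q b, z) \<in> parcs Z")
    case True
    then have "(q b, z) \<in> map_prod q q ` out_arcs (with_proj Y) b"
      using bij by (simp add: bij_betw_def)
    then obtain c where c: "(b, c) \<in> parcs Y" "q c = z" by auto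
    have "c' = c" if "(b, c') \<in> parcs Y" "q c' = z" for c'
      using bij_betw_imp_inj_on[OF bij] c that
      by (auto dest!: inj_onD[where x = "(b, c')" and y = "(b, c)"])
    then have "fibre Y q z \<inter> {c. (b, c) \<in> parcs Y} = {c}"
      using c wf unfolding fibre_def by blast
    then show ?thesis using True by simp
  next
    case False
    then have "fibre Y q z \<inter> {c. (b, c) \<in> parcs Y} = {}"
      using cov by (auto simp: fibre_def covering_map_def)
    then show ?thesis using False by simp
  qed
  moreover have "finite (fibre Y q z)" using fin by (simp add: fibre_def)
  ultimately show ?thesis by (simp add: sum_of_bool_eq)
qed

text \<open>A walk from \<open>q u\<close> has exactly one lift starting at \<open>u\<close>. The
  end of the lift is only known to lie over \<open>z\<close>, hence the sum over the fibre.\<close>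

lemma num_walks_covering_map:
  assumes cov: "covering_map Y Z q"
    and fin: "finite (pverts Y)" and wf: "parcs Y \<subseteq> pverts Y \<times> pverts Y"
    and u: "u \<in> pverts Y"
  shows "num_walks Z k (q u) z = (\<Sum>b\<in>fibre Y q z. num_walks Y k u b)"
proof (induction k arbitrary: z)
  case 0
  have "fibre Y q z \<inter> {b. u = b} = (if q u = z then {u} else {})"
    using u by (auto simp: fibre_def)
  moreover have "finite (fibre Y q z)" using fin by (simp add: fibre_def)
  ultimately show ?case by (simp add: sum_of_bool_eq)
next
  case (Suc k)
  have img: "q ` pverts Y = pverts Z" using cov by (simp add: covering_map_def)
  have "num_walks Z (Suc k) (q u) z
      = (\<Sum>w\<in>pverts Z. \<Sum>b\<in>{b \<in> pverts Y. q b = w}.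
           num_walks Y k u b * of_bool ((q b, z) \<in> parcs Z))"
    by (simp add: Suc sum_distrib_right fibre_def)
  also have "\<dots> = (\<Sum>b\<in>pverts Y. num_walks Y k u b * of_bool ((q b, z) \<in> parcs Z))"
    by (rule sum.group) (use fin img in \<open>auto simp flip: img\<close>)
  \<comment> \<open>The last arc, still in \<open>Z\<close>, is replaced by its unique lift at
    \<open>b\<close>.\<close>
  also have "\<dots> = (\<Sum>b\<in>pverts Y. \<Sum>c\<in>fibre Y q z. num_walks Y k u b * of_bool ((b, c) \<in> parcs Y))"
    by (intro sum.cong refl)
      (simp add: num_lifts_covering_map[OF cov _ fin wf] flip: sum_distrib_left)
  also have "\<dots> = (\<Sum>c\<in>fibre Y q z. num_walks Y (Suc k) u c)"
    by (subst sum.swap) simp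
  finally show ?case .
qed

text \<open>This is the function \<open>F\<close> of the introductory sketch. When
  \<open>act g\<close> permutes the vertices, it is the trace of the \<open>k\<close>-th power of
  the adjacency matrix times the permutation matrix of \<open>act g\<close>.\<close>

definition num_twisted_closed_walks ::
  "'a pair_pre_digraph \<Rightarrow> ('g \<Rightarrow> 'a \<Rightarrow> 'a) \<Rightarrow> nat \<Rightarrow> 'g \<Rightarrow> nat" where
  "num_twisted_closed_walks Y act k g = (\<Sum>u\<in>pverts Y. num_walks Y k u (act g u))"

text \<open>A closed walk at \<open>q u\<close> lifts to a walk from \<open>u\<close> to
  \<open>act h u\<close> for a unique \<open>h\<close> in \<open>H\<close>. Letting \<open>u\<close>
  run through all of \<open>Y\<close> meets each vertex of \<open>Z\<close> exactly
  \<open>card H\<close> times. With \<open>q\<close> and \<open>H\<close> abstract, the count serves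
  both the cover of \<open>X\<close> and the covers of the intermediate quotients.\<close>

lemma num_closed_walks_regular_cover:
  assumes cov: "covering_map Y Z q"
    and fin: "finite (pverts Y)" and wf: "parcs Y \<subseteq> pverts Y \<times> pverts Y"
    and reg: "\<And>u. u \<in> pverts Y \<Longrightarrow> bij_betw (\<lambda>h. act h u) H (fibre Y q (q u))"
  shows "card H * num_closed_walks Z k = (\<Sum>h\<in>H. num_twisted_closed_walks Y act k h)"
proof -
  have img: "q ` pverts Y = pverts Z" using cov by (simp add: covering_map_def)
  have card: "card (fibre Y q w) = card H" if "w \<in> pverts Z" for w
    using that bij_betw_same_card[OF reg] by (auto simp flip: img)
  have "card H * num_closed_walks Z k
      = (\<Sum>w\<in>pverts Z. \<Sum>u\<in>{u \<in> pverts Y. q u = w}. num_walks Z k (q u) (q u))"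
    using card by (simp add: num_closed_walks_def sum_distrib_left fibre_def)
  also have "\<dots> = (\<Sum>u\<in>pverts Y. num_walks Z k (q u) (q u))"
    by (rule sum.group) (use fin img in \<open>auto simp flip: img\<close>)
  also have "\<dots> = (\<Sum>u\<in>pverts Y. \<Sum>h\<in>H. num_walks Y k u (act h u))"
  proof (rule sum.cong)
    fix u assume u: "u \<in> pverts Y"
    show "num_walks Z k (q u) (q u) = (\<Sum>h\<in>H. num_walks Y k u (act h u))"
      unfolding num_walks_covering_map[OF cov fin wf u]
      by (rule sum.reindex_bij_betw[OF reg[OF u], symmetric])
  qed simp
  also have "\<dots> = (\<Sum>h\<in>H. num_twisted_closed_walks Y act k h)"
    unfolding num_twisted_closed_walks_def by (rule sum.swap)
  finally show ?thesis .
qed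

section \<open>Galois covers: the free action on fibres\<close>

context
  fixes Y :: "'a pair_pre_digraph" and X :: "'b pair_pre_digraph" and p :: "'a \<Rightarrow> 'b"
    and G :: "('g, 'm) monoid_scheme" (structure) and act :: "'g \<Rightarrow> 'a \<Rightarrow> 'a"
  assumes Y: "pair_graph Y" and galois: "galois_cover Y X p G act"
begin

interpretation pair_graph Y by (rule Y)

interpretation act: group_action G "pverts Y" act
  using galois by (simp add: galois_cover_def)

interpretation G: group G
  using act.group_hom by (rule group_hom.axioms)

lemma covering_map_galois: "covering_map Y X p"
  using galois by (simp add: galois_cover_def)

lemma act_closed: "g \<in> carrier G \<Longrightarrow> u \<in> pverts Y \<Longrightarrow> act g u \<in> pverts Y"
  using act.element_image by blast

lemma act_arc_iff:
  "g \<in> carrier G \<Longrightarrow> u \<in> pverts Y \<Longrightarrow> v \<in> pverts Y \<Longrightarrow>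
     (act g u, act g v) \<in> parcs Y \<longleftrightarrow> (u, v) \<in> parcs Y"
  using galois by (simp add: galois_cover_def)

lemma galois_fibre:
  assumes "u \<in> pverts Y"
  shows "p u \<in> pverts X" and "u \<in> fibre Y p (p u)"
  using assms covering_map_galois by (auto simp: covering_map_def fibre_def)

lemma proj_act: "g \<in> carrier G \<Longrightarrow> u \<in> pverts Y \<Longrightarrow> p (act g u) = p u"
  using galois galois_fibre[of u] by (fastforce simp: galois_cover_def fibre_def)

lemma inj_on_act:
  assumes u: "u \<in> pverts Y"
  shows "inj_on (\<lambda>g. act g u) (carrier G)"
proof (rule inj_onI)
  fix g h assume gh: "g \<in> carrier G" "h \<in> carrier G" "act g u = act h u"
  have "act (inv h \<otimes> g) u = u"
    using gh u act.orbit_sym_aux[of h u] by (simp add: act.composition_rule)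
  then have "inv h \<otimes> g \<in> stabilizer G act u"
    using gh by (simp add: stabilizer_def)
  moreover have "stabilizer G act u = {\<one>}"
    using galois galois_fibre[OF u] by (simp add: galois_cover_def)
  ultimately show "g = h"
    using gh by (metis G.inv_closed G.inv_equality G.inv_inv singletonD)
qed

lemma bij_betw_act_fibre:
  assumes u: "u \<in> pverts Y"
  shows "bij_betw (\<lambda>g. act g u) (carrier G) (fibre Y p (p u))"
proof -
  have "\<exists>g\<in>carrier G. act g u = v" if "v \<in> fibre Y p (p u)" for v
    using that galois galois_fibre[OF u] by (simp add: galois_cover_def)
  then show ?thesis
    using inj_on_act[OF u] u by (auto simp: bij_betw_def fibre_def proj_act act_closed)
qed

section \<open>Quotients by a subgroup as intermediate covers\<close>

context
  fixes H assumes H: "subgroup H G"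
begin

abbreviation (input) "orb \<equiv> orbit (G\<lparr>carrier := H\<rparr>) act"

interpretation H: group_action "G\<lparr>carrier := H\<rparr>" "pverts Y" act
  by (rule act.induced_action[OF H])

lemma orb_def: "orb u = (\<lambda>h. act h u) ` H"
  by (auto simp: orbit_def)

lemma orb_eq_iff:
  assumes "u \<in> pverts Y" "v \<in> pverts Y"
  shows "orb v = orb u \<longleftrightarrow> v \<in> orb u"
proof -
  have sub: "orb w \<subseteq> pverts Y" if "w \<in> pverts Y" for w
    using that subgroup.subset[OF H] by (auto simp: orb_def act_closed)
  show ?thesis
  proof
    assume "orb v = orb u"
    then show "v \<in> orb u" using H.orbit_refl[OF assms(2)] by simp
  next
    assume v: "v \<in> orb u"
    have "orb v \<subseteq> orb u"
      using H.orbit_trans[OF assms(1,2) _ v] sub[OF assms(2)] by blast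
    moreover have "orb u \<subseteq> orb v"
      using H.orbit_trans[OF assms(2,1) _ H.orbit_sym[OF assms v]] sub[OF assms(1)] by blast
    ultimately show "orb v = orb u" by (rule equalityI)
  qed
qed

text \<open>The fibre of the orbit map over \<open>orb u\<close> is the set \<open>orb u\<close>
  itself, and freeness of the action makes its parametrisation by \<open>H\<close>
  injective.\<close>

lemma bij_betw_act_orbit:
  assumes u: "u \<in> pverts Y"
  shows "bij_betw (\<lambda>h. act h u) H (fibre Y orb (orb u))"
proof -
  have "orb u \<subseteq> pverts Y"
    using u subgroup.subset[OF H] by (auto simp: orb_def act_closed)
  then have "fibre Y orb (orb u) = orb u"
    using u orb_eq_iff by (auto simp: fibre_def)
  then show ?thesis
    using inj_on_subset[OF inj_on_act[OF u] subgroup.subset[OF H]]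
    by (simp add: bij_betw_def orb_def)
qed

text \<open>Local injectivity is inherited from \<open>p\<close>: neighbours of \<open>v\<close> in
  the same orbit have the same image under \<open>p\<close>, so they coincide. For local
  surjectivity, an arc out of \<open>orb v\<close> comes from some arc \<open>(a, b)\<close> with
  \<open>a = act h v\<close>; translating it by the inverse of \<open>h\<close> makes it start at
  \<open>v\<close> without changing the orbit of \<open>b\<close>.\<close>

lemma covering_map_quotient_graph: "covering_map Y (quotient_graph Y G act H) orb"
proof -
  let ?Z = "quotient_graph Y G act H"
  have H_sub: "H \<subseteq> carrier G" using subgroup.subset[OF H] .
  have verts: "pverts ?Z = orb ` pverts Y"
    by (auto simp: quotient_graph_def Let_def orbits_def)
  have arcs: "(A, B) \<in> parcs ?Z \<longleftrightarrow>
      A \<in> pverts ?Z \<and> B \<in> pverts ?Z \<and> (\<exists>a\<in>A. \<exists>b\<in>B. (a, b) \<in> parcs Y)" for A B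
    by (auto simp: quotient_graph_def Let_def)
  have arc: "(orb u, orb v) \<in> parcs ?Z" if "(u, v) \<in> parcs Y" for u v
    using that in_arcsD1 in_arcsD2 H.orbit_refl unfolding arcs verts by blast
  have "bij_betw (map_prod orb orb) (out_arcs (with_proj Y) v) (out_arcs (with_proj ?Z) (orb v))"
    if v: "v \<in> pverts Y" for v
    unfolding bij_betw_def
  proof
    have "c = c'" if c: "(v, c) \<in> parcs Y" "(v, c') \<in> parcs Y" and eq: "orb c = orb c'" for c c'
    proof -
      have "c \<in> orb c'" using c eq in_arcsD2 H.orbit_refl by blast
      then have "p c = p c'" using c H_sub in_arcsD2 by (auto simp: orb_def proj_act)
      moreover have "inj_on (map_prod p p) (out_arcs (with_proj Y) v)"
        using covering_map_galois v by (auto simp: covering_map_def bij_betw_def)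
      ultimately show ?thesis
        using c by (auto dest!: inj_onD[where x = "(v, c)" and y = "(v, c')"])
    qed
    then show "inj_on (map_prod orb orb) (out_arcs (with_proj Y) v)"
      by (auto simp: inj_on_def)
  next
    have "\<exists>c. (v, c) \<in> parcs Y \<and> orb c = B" if B: "(orb v, B) \<in> parcs ?Z" for B
    proof -
      from B obtain a b where ab: "a \<in> orb v" "b \<in> B" "(a, b) \<in> parcs Y"
        by (auto simp: arcs)
      then obtain h where h: "h \<in> H" "a = act h v" by (auto simp: orb_def)
      have vb: "b \<in> pverts Y" using ab in_arcsD2 by blast
      have "B = orb b"
        using B ab(2) vb H_sub orb_eq_iff unfolding arcs verts by blast
      have hi: "inv h \<in> H" using H h by (simp add: subgroup.m_inv_closed)
      let ?c = "act (inv h) b"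
      have c: "?c \<in> pverts Y" "?c \<in> orb b"
        using hi H_sub vb by (auto simp: orb_def act_closed)
      have "act (inv h) a = v"
        using h H_sub v act.orbit_sym_aux by blast
      then have "(v, ?c) \<in> parcs Y"
        using act_arc_iff[of "inv h" a b] ab hi H_sub vb in_arcsD1 by auto
      moreover have "orb ?c = B"
        using c vb orb_eq_iff \<open>B = orb b\<close> by blast
      ultimately show ?thesis by blast
    qed
    then show "map_prod orb orb ` out_arcs (with_proj Y) v = out_arcs (with_proj ?Z) (orb v)"
      using arc by (force simp: image_iff)
  qed
  then show ?thesis using arc verts by (auto simp: covering_map_def)
qed

lemma finite_pverts_quotient_graph: "finite (pverts (quotient_graph Y G act H))"
  using covering_map_quotient_graph pair_finite_verts
  by (metis covering_map_def finite_imageI)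

lemma num_closed_walks_quotient_graph:
  "card H * num_closed_walks (quotient_graph Y G act H) k
     = (\<Sum>h\<in>H. num_twisted_closed_walks Y act k h)"
  using covering_map_quotient_graph pair_finite_verts in_arcsD1 in_arcsD2 bij_betw_act_orbit
  by (intro num_closed_walks_regular_cover) auto

end

lemma num_closed_walks_galois_cover:
  "order G * num_closed_walks X k = (\<Sum>g\<in>carrier G. num_twisted_closed_walks Y act k g)"
  unfolding order_def
  using covering_map_galois pair_finite_verts in_arcsD1 in_arcsD2 bij_betw_act_fibre
  by (intro num_closed_walks_regular_cover) auto

lemma num_walks_act:
  assumes g: "g \<in> carrier G" and u: "u \<in> pverts Y"
  shows "v \<in> pverts Y \<Longrightarrow> num_walks Y k (act g u) (act g v) = num_walks Y k u v"
proof (induction k arbitrary: v)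
  case 0
  then show ?case using act.inj_prop[OF g] u by (auto simp: inj_on_def)
next
  case (Suc k)
  have "bij_betw (act g) (pverts Y) (pverts Y)"
    using act.inj_prop[OF g] act.surj_prop[OF g] by (simp add: bij_betw_def)
  from sum.reindex_bij_betw[OF this, symmetric]
  have "num_walks Y (Suc k) (act g u) (act g v)
      = (\<Sum>w\<in>pverts Y. num_walks Y k (act g u) (act g w) * of_bool ((act g w, act g v) \<in> parcs Y))"
    unfolding num_walks.simps .
  also have "\<dots> = num_walks Y (Suc k) u v"
    unfolding num_walks.simps using Suc g by (intro sum.cong) (simp_all add: act_arc_iff)
  finally show ?case .
qed

text \<open>Invariance under conjugation, stated without inverses. Substituting
  \<open>act g u\<close> for \<open>u\<close> yields walks from \<open>g u\<close> to
  \<open>g h g u\<close>; the automorphism \<open>g\<close> can be removed from both ends, leaving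
  walks from \<open>u\<close> to \<open>h g u\<close>.\<close>

lemma num_twisted_closed_walks_commute:
  assumes g: "g \<in> carrier G" and h: "h \<in> carrier G"
  shows "num_twisted_closed_walks Y act k (g \<otimes> h) = num_twisted_closed_walks Y act k (h \<otimes> g)"
proof -
  have "bij_betw (act g) (pverts Y) (pverts Y)"
    using act.inj_prop[OF g] act.surj_prop[OF g] by (simp add: bij_betw_def)
  from sum.reindex_bij_betw[OF this, symmetric]
  have "num_twisted_closed_walks Y act k (g \<otimes> h)
      = (\<Sum>u\<in>pverts Y. num_walks Y k (act g u) (act (g \<otimes> h) (act g u)))"
    unfolding num_twisted_closed_walks_def .
  also have "\<dots> = (\<Sum>u\<in>pverts Y. num_walks Y k (act g u) (act g (act (h \<otimes> g) u)))"
    using g h by (intro sum.cong) (simp_all add: act.composition_rule act_closed)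
  also have "\<dots> = num_twisted_closed_walks Y act k (h \<otimes> g)"
    unfolding num_twisted_closed_walks_def using g h
    by (intro sum.cong) (simp_all add: num_walks_act act_closed)
  finally show ?thesis .
qed

lemma num_twisted_closed_walks_one:
  "num_twisted_closed_walks Y act k \<one> = num_closed_walks Y k"
  by (simp add: num_twisted_closed_walks_def num_closed_walks_def flip: act.id_eq_one)

end

section \<open>Cyclic subgroups and the symmetric group of degree 3\<close>

lemma (in group) generate_order_2:
  assumes a: "a \<in> carrier G" and rel: "a \<otimes> a = \<one>"
  shows "generate G {a} = {\<one>, a}"
proof
  have inv: "inv a = a" using a rel by (simp add: inv_equality)
  have "h \<in> {\<one>, a}" if "h \<in> generate G {a}" for h
    using that by induction (use a rel inv in auto)
  then show "generate G {a} \<subseteq> {\<one>, a}" by blast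
  show "{\<one>, a} \<subseteq> generate G {a}"
    by (auto intro: generate.one generate.incl)
qed

lemma (in group) generate_order_3:
  assumes a: "a \<in> carrier G" and rel: "a \<otimes> (a \<otimes> a) = \<one>"
  shows "generate G {a} = {\<one>, a, a \<otimes> a}"
proof
  have inv: "inv a = a \<otimes> a" using a rel by (simp add: inv_equality m_assoc)
  \<comment> \<open>After reassociation, the left-hand side is the product of
    \<open>a \<otimes> a\<close> with itself.\<close>
  have rel4: "a \<otimes> (a \<otimes> (a \<otimes> a)) = a" using a rel by simp
  have "h \<in> {\<one>, a, a \<otimes> a}" if "h \<in> generate G {a}" for h
    using that by induction (use a rel rel4 inv in \<open>auto simp: m_assoc\<close>)
  then show "generate G {a} \<subseteq> {\<one>, a, a \<otimes> a}" by blast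
  show "{\<one>, a, a \<otimes> a} \<subseteq> generate G {a}"
    by (auto intro: generate.one generate.incl generate.eng)
qed

abbreviation (input) c3 :: "nat \<Rightarrow> nat" where "c3 \<equiv> cycle_of_list [1, 2, 3]"
abbreviation (input) s2 :: "nat \<Rightarrow> nat" where "s2 \<equiv> cycle_of_list [1, 2]"

text \<open>The dihedral relations: the last one moves \<open>s2\<close> to the right past
  \<open>c3\<close>, so every word reduces to a power of \<open>c3\<close> followed by a power of
  \<open>s2\<close>.\<close>

lemma sym_group_3_relations:
  "c3 \<circ> c3 \<circ> c3 = id" "s2 \<circ> s2 = id" "s2 \<circ> c3 = c3 \<circ> c3 \<circ> s2"
  by (auto simp: fun_eq_iff transpose_def)

lemma distinct_sym_group_3:
  "distinct [id, c3, c3 \<circ> c3, s2, c3 \<circ> s2, c3 \<circ> c3 \<circ> s2]"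
proof -
  \<comment> \<open>A permutation of three letters is determined by two of its values, so these
    pairs already separate the six elements.\<close>
  have "distinct (map (\<lambda>g. (g 1, g 2)) [id, c3, c3 \<circ> c3, s2, c3 \<circ> s2, c3 \<circ> c3 \<circ> s2])"
    by (simp add: transpose_def)
  then show ?thesis unfolding distinct_map by blast
qed

lemma cycles_in_sym_group_3: "c3 \<in> carrier (sym_group 3)" "s2 \<in> carrier (sym_group 3)"
  using cycle_permutes[of "[1, 2, 3 :: nat]"] cycle_permutes[of "[1, 2 :: nat]"]
  by (auto simp: sym_group_carrier intro: permutes_subset simp del: cycle_of_list.simps)

text \<open>The six listed elements are distinct and the group has order 3! = 6, so inclusion forces
  equality.\<close>

lemma carrier_sym_group_3:
  "carrier (sym_group 3) = set [id, c3, c3 \<circ> c3, s2, c3 \<circ> s2, c3 \<circ> c3 \<circ> s2]"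
proof (rule card_subset_eq[symmetric])
  show "finite (carrier (sym_group 3))"
    by (simp add: sym_group_def finite_permutations)
  have "card (carrier (sym_group 3)) = fact 3"
    by (simp add: sym_group_def card_permutations)
  then show "card (set [id, c3, c3 \<circ> c3, s2, c3 \<circ> s2, c3 \<circ> c3 \<circ> s2]) = card (carrier (sym_group 3))"
    unfolding distinct_card[OF distinct_sym_group_3] by (simp add: fact_numeral)
  show "set [id, c3, c3 \<circ> c3, s2, c3 \<circ> s2, c3 \<circ> c3 \<circ> s2] \<subseteq> carrier (sym_group 3)"
    using cycles_in_sym_group_3
    by (auto simp: sym_group_carrier permutes_id intro!: permutes_compose simp del: cycle_of_list.simps)
qed

lemma generate_c3: "generate (sym_group 3) {c3} = {id, c3, c3 \<circ> c3}"
  using group.generate_order_3[OF sym_group_is_group cycles_in_sym_group_3(1)]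
    sym_group_3_relations(1)
  by (simp only: sym_group_mult sym_group_one comp_assoc)

lemma generate_s2: "generate (sym_group 3) {s2} = {id, s2}"
  using group.generate_order_2[OF sym_group_is_group cycles_in_sym_group_3(2)]
    sym_group_3_relations(2)
  by (simp only: sym_group_mult sym_group_one)

lemma class_function_sym_group_3:
  assumes comm: "\<And>g h. g \<in> carrier (sym_group 3) \<Longrightarrow> h \<in> carrier (sym_group 3) \<Longrightarrow>
      F (g \<circ> h) = F (h \<circ> g)"
  shows "F (c3 \<circ> c3) = F c3" and "F (c3 \<circ> s2) = F s2" and "F (c3 \<circ> c3 \<circ> s2) = F s2"
proof -
  \<comment> \<open>Opaque names keep the cycles from being unfolded; the relations then act as
    pointwise rewrite rules.\<close>
  define c s where "c = c3" and "s = s2"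
  note rel = sym_group_3_relations[folded c_def s_def]
  have c: "c (c (c x)) = x" and s: "s (s x) = x" and sc: "s (c x) = c (c (s x))" for x
    using rel by (metis comp_apply id_apply)+
  have carr: "c \<in> carrier (sym_group 3)" "s \<in> carrier (sym_group 3)"
    using cycles_in_sym_group_3 by (simp_all only: c_def s_def)
  have comp: "g \<circ> h \<in> carrier (sym_group 3)"
    if "g \<in> carrier (sym_group 3)" "h \<in> carrier (sym_group 3)" for g h
    using that by (simp add: sym_group_carrier permutes_compose)
  \<comment> \<open>In each instance one order of the factors multiplies out to the element in
    question and the other to its class representative \<open>c\<close> or \<open>s\<close>.\<close>
  have "F (s \<circ> (c \<circ> s)) = F ((c \<circ> s) \<circ> s)"
    "F ((c \<circ> c) \<circ> (s \<circ> c)) = F ((s \<circ> c) \<circ> (c \<circ> c))"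
    "F (c \<circ> (s \<circ> (c \<circ> c))) = F ((s \<circ> (c \<circ> c)) \<circ> c)"
    by (intro comm comp carr)+
  moreover have "s \<circ> (c \<circ> s) = c \<circ> c" "(c \<circ> s) \<circ> s = c"
    "(c \<circ> c) \<circ> (s \<circ> c) = c \<circ> s" "(s \<circ> c) \<circ> (c \<circ> c) = s"
    "c \<circ> (s \<circ> (c \<circ> c)) = c \<circ> c \<circ> s" "(s \<circ> (c \<circ> c)) \<circ> c = s"
    by (simp_all add: fun_eq_iff c s sc)
  ultimately show "F (c3 \<circ> c3) = F c3" and "F (c3 \<circ> s2) = F s2" and "F (c3 \<circ> c3 \<circ> s2) = F s2"
    unfolding c_def[symmetric] s_def[symmetric] by simp_all
qed

section \<open>Comparing the closed walk counts of the four graphs\<close>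

theorem corollary1:
  fixes Y :: "'a pair_pre_digraph" and X :: "'b pair_pre_digraph" and p :: "'a \<Rightarrow> 'b"
    and G :: "('g, 'm) monoid_scheme" and act :: "'g \<Rightarrow> 'a \<Rightarrow> 'a"
    and f :: "(nat \<Rightarrow> nat) \<Rightarrow> 'g"
    and Q T :: "'a set pair_pre_digraph"
  assumes "pair_graph Y" and "pair_graph X"
    and "galois_cover Y X p G act"
    and "f \<in> iso (sym_group 3) G"
    and "Q = quotient_graph Y G act (f ` generate (sym_group 3) {cycle_of_list [1, 2, 3]})"
    and "T = quotient_graph Y G act (f ` generate (sym_group 3) {cycle_of_list [1, 2]})"
  shows "Spec Y + Spec X + Spec X = Spec Q + Spec T + Spec T"
proof (rule multiset_eq_if_power_sums_eq)
  fix k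
  let ?S = "sym_group 3"
  interpret Y: pair_graph Y by (rule assms)
  interpret X: pair_graph X by (rule assms)
  have G: "group G"
    using \<open>galois_cover Y X p G act\<close>
    by (auto simp: galois_cover_def group_action_def group_hom_def)
  have f: "f \<in> hom ?S G" "bij_betw f (carrier ?S) (carrier G)"
    using \<open>f \<in> iso ?S G\<close> by (simp_all add: iso_def)
  interpret f: group_hom ?S G f
    using f(1) G sym_group_is_group by (simp add: group_hom_def group_hom_axioms_def)
  \<comment> \<open>Pulling the twisted counts back along \<open>f\<close> reduces all sums over
    \<open>G\<close> and its subgroups to sums over explicit permutations.\<close>
  define F where "F \<sigma> = num_twisted_closed_walks Y act k (f \<sigma>)" for \<sigma>
  have comm: "F (g \<circ> h) = F (h \<circ> g)" if "g \<in> carrier ?S" "h \<in> carrier ?S" for g h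
    using that f.hom_mult[of g h] f.hom_mult[of h g]
      num_twisted_closed_walks_commute[OF assms(1,3), of "f g" "f h"]
    by (simp add: F_def sym_group_mult)
  note F_class = class_function_sym_group_3[of F, OF comm]
  have F_one: "F id = num_closed_walks Y k"
    using f.hom_one num_twisted_closed_walks_one[OF assms(1,3)] by (simp add: F_def sym_group_one)
  have sum_F: "(\<Sum>h\<in>f ` K. num_twisted_closed_walks Y act k h) = sum F K"
    and card_image_f: "card (f ` K) = card K" if "K \<subseteq> carrier ?S" for K
    using inj_on_subset[OF bij_betw_imp_inj_on[OF f(2)] that]
    by (simp_all add: F_def sum.reindex card_image)
  have gen: "generate ?S {\<sigma>} \<subseteq> carrier ?S" "subgroup (f ` generate ?S {\<sigma>}) G"
    if "\<sigma> \<in> carrier ?S" for \<sigma>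
    using that f.G.generate_incl[of "{\<sigma>}"] f.G.generate_is_subgroup[of "{\<sigma>}"]
      f.subgroup_img_is_subgroup by auto
  note gen_c = gen[OF cycles_in_sym_group_3(1)] and gen_s = gen[OF cycles_in_sym_group_3(2)]
  have sum_S: "sum F (set \<sigma>s) = sum_list (map F \<sigma>s)" "card (set \<sigma>s) = length \<sigma>s"
    if "distinct \<sigma>s" for \<sigma>s
    using that by (simp_all add: sum_list_distinct_conv_sum_set distinct_card)
  \<comment> \<open>The coefficients 1, 3, 2 are the sizes of the classes of the identity, the
    transpositions and the 3-cycles.\<close>
  have "6 * num_closed_walks X k = F id + 3 * F s2 + 2 * F c3"
    using num_closed_walks_galois_cover[OF assms(1,3), of k] sum_F[OF order_refl]
      card_image_f[OF order_refl] bij_betw_imp_surj_on[OF f(2)] sum_S[OF distinct_sym_group_3] F_class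
    unfolding order_def carrier_sym_group_3 by simp
  moreover have "3 * num_closed_walks Q k = F id + 2 * F c3"
  proof -
    have "distinct [id, c3, c3 \<circ> c3]"
      using distinct_sym_group_3 by (simp del: cycle_of_list.simps)
    from sum_S[OF this] show ?thesis
      using num_closed_walks_quotient_graph[OF assms(1,3) gen_c(2), of k]
        sum_F[OF gen_c(1)] card_image_f[OF gen_c(1)] F_class(1)
      unfolding assms generate_c3 by (simp del: cycle_of_list.simps)
  qed
  moreover have "2 * num_closed_walks T k = F id + F s2"
  proof -
    have "distinct [id, s2]"
      using distinct_sym_group_3 by (simp del: cycle_of_list.simps)
    from sum_S[OF this] show ?thesis
      using num_closed_walks_quotient_graph[OF assms(1,3) gen_s(2), of k]
        sum_F[OF gen_s(1)] card_image_f[OF gen_s(1)]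
      unfolding assms generate_s2 by (simp del: cycle_of_list.simps)
  qed
  \<comment> \<open>Adding \<open>F id\<close> to a third of the first equation gives the same value
    as adding the third equation to a third of the second.\<close>
  ultimately have "num_closed_walks Y k + num_closed_walks X k + num_closed_walks X k
      = num_closed_walks Q k + num_closed_walks T k + num_closed_walks T k"
    using F_one by linarith
  moreover have "finite (pverts Q)" "finite (pverts T)"
    unfolding assms
    by (rule finite_pverts_quotient_graph[OF assms(1,3)], rule gen_c gen_s)+
  ultimately show "(\<Sum>x\<in>#Spec Y + Spec X + Spec X. x ^ k) = (\<Sum>x\<in>#Spec Q + Spec T + Spec T. x ^ k)"
    by (simp add: power_sum_Spec Y.pair_finite_verts X.pair_finite_verts flip: of_nat_add)
qed

end
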